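(* Consider the coupled initial value problem $$\dot y_S=f_S(t,y_S,y_F),\quad y_S(t_0)=y_{S,0},\qquad \dot y_F=f_F(t,y_S,y_F),\quad y_F(t_0)=y_{F,0},\qquad t\in(t_0,t_{\mathrm{end}}],$$ with $y_S(t)\in\mathbb{R}^{m_S}$, $y_F(t)\in\mathbb{R}^{m_F}$, where $f_S$ and $f_F$ are continuous and Lipschitz continuous with respect to $(y_S,y_F)$. Let $p\ge 1$ be an integer and let $m\in\mathbb{N}$ be a fixed multirate factor. Suppose two basic integration schemes of order $p$ are used: one for $y_S$ with a single step of macro step size $H$, and one for $y_F$ with $m$ steps of micro step size $h=H/m$. Suppose these are combined in the slowest-first multirate approach on each macro step $[\bar t,\bar t+H]\subseteq[t_0,t_{\mathrm{end}}]$: the coupling variable $y_F$ in the slow subsystem is evaluated by an extrapolation procedure of order $p-1$, and the coupling variable $y_S$ in the fast subsystem is evaluated by an interpolation procedure of order $p-1$ based on the slow data already computed in the current macro step. Then the resulting slowest-first multirate scheme has (consistency) order $p$ on the macro step level, i.e. $$\|y_{S,H}(\bar t+H)-y_S(\bar t+H)\|=\mathcal{O}(H^{p+1}),\qquad \|y_{F,H}(\bar t+H)-y_F(\bar t+H)\|=\mathcal{O}(H^{p+1})\quad (H\to 0),$$ where $(y_S,y_F)$ is the exact solution of the coupled system through the data at $\bar t$ and $(y_{S,H},y_{F,H})$ is the multirate numerical solution started from the same data.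
   Context: One macro step. At time $\bar t$ data $y_S(\bar t)=y_{S,\bar t}$, $y_F(\bar t)=y_{F,\bar t}$ are given; $(y_S(t),y_F(t))$ denotes the unique exact solution of the coupled system on $[\bar t,\bar t+H]$ with these data. Extrapolation of order $p-1$ for $y_F$: a known (continuous) function $\tilde y_F$ on $[\bar t,\bar t+H]$, built from information available at $\bar t$ (or from the preceding macro step), with $\|y_F(t)-\tilde y_F(t)\|\le L_F H^p+\mathcal{O}(H^{p+1})$ for all $t\in[\bar t,\bar t+H]$, with a constant $L_F>0$ independent of $H$. Slowest-first approach. First the slow variables are integrated over $[\bar t,\bar t+H]$ by one macro step of the slow basic scheme applied to $\dot y_S=f_S(t,y_S,\tilde y_F(t))$, $y_S(\bar t)=y_{S,\bar t}$. Then $m$ micro steps of the fast basic scheme are applied to $\dot y_F=f_F(t,y_S^{int}(t),y_F)$, $y_F(\bar t)=y_{F,\bar t}$, where $y_S^{int}$ is a (continuous) interpolated waveform built from the numerical slow approximations $y_{S,H}(t_k)$, $t_k\in[\bar t,\bar t+H]$. Let $\hat y_S,\hat y_F$ denote the exact solutions of these two modified initial value problems, and $y_{S,H}(\bar t+H)$, $y_{F,H}(\bar t+H)$ the numerical results. Interpolation of order $p-1$: $\|\hat y_S(t)-y_S^{int}(t)\|\le \tilde L_S H^p+\mathcal{O}(H^{p+1})$ for all $t\in[\bar t,\bar t+H]$, with $\tilde L_S>0$ independent of $H$. Basic integration scheme of order $p$: the scheme for a subsystem with given coupling data has order $p$, i.e. applied to the modified (decoupled) subsystems above one has $\|y_{S,H}(\bar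 t+H)-\hat y_S(\bar t+H)\|\le c_S H^{p+1}+\mathcal{O}(H^{p+2})$ and $\|y_{F,H}(\bar t+H)-\hat y_F(\bar t+H)\|\le c_F H^{p+1}+\mathcal{O}(H^{p+2})$, with constants $c_S,c_F>0$ independent of $H$. *)

theory Defs
  imports "HOL-Analysis.Analysis" "HOL-Library.Landau_Symbols"
begin

definition ivp_solution ::
  "(real \<Rightarrow> 'a \<Rightarrow> 'a) \<Rightarrow> real \<Rightarrow> real \<Rightarrow> 'a::real_normed_vector \<Rightarrow> (real \<Rightarrow> 'a) \<Rightarrow> bool" where
  "ivp_solution g a b y0 y \<longleftrightarrow>
     y a = y0 \<and> continuous_on {a..b} y \<and>
     (\<forall>t\<in>{a<..b}. (y has_vector_derivative g t (y t)) (at t within {a..b}))"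

text \<open>
  A one-step scheme maps a right-hand side, a time, a value at that time and a step size
  to the numerical value at the end of the step.
\<close>
type_synonym 'a one_step = "(real \<Rightarrow> 'a \<Rightarrow> 'a) \<Rightarrow> real \<Rightarrow> 'a \<Rightarrow> real \<Rightarrow> 'a"

primrec steps :: "'a one_step \<Rightarrow> (real \<Rightarrow> 'a \<Rightarrow> 'a) \<Rightarrow> real \<Rightarrow> 'a \<Rightarrow> real \<Rightarrow> nat \<Rightarrow> 'a" where
  "steps \<Phi> g t y h 0 = y"
| "steps \<Phi> g t y h (Suc k) = \<Phi> g (t + real k * h) (steps \<Phi> g t y h k) h"

text \<open>
  In the following two definitions the first argument of every function is the macro step
  size \<open>H\<close>, the second one is time. Order \<open>q\<close> of an inter- or extrapolation means an error
  bound \<open>L H^(q+1) + O(H^(q+2))\<close> that is uniform in time over the macro step; order \<open>p\<close> of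
  an integration scheme means a local error bound \<open>c H^(p+1) + O(H^(p+2))\<close> at the end of
  the macro step.
\<close>
definition waveform_order ::
  "nat \<Rightarrow> real \<Rightarrow> (real \<Rightarrow> real \<Rightarrow> 'a::real_normed_vector) \<Rightarrow> (real \<Rightarrow> real \<Rightarrow> 'a) \<Rightarrow> bool" where
  "waveform_order q tb y w \<longleftrightarrow>
     (\<exists>L>0. \<exists>r\<in>O[at_right 0](\<lambda>H. H ^ (q + 2)).
        \<forall>\<^sub>F H in at_right 0. \<forall>t\<in>{tb..tb + H}.
          norm (y H t - w H t) \<le> L * H ^ (q + 1) + r H)"

definition integration_order ::
  "nat \<Rightarrow> real \<Rightarrow> (real \<Rightarrow> real \<Rightarrow> 'a::real_normed_vector) \<Rightarrow> (real \<Rightarrow> real \<Rightarrow> 'a) \<Rightarrow> bool" where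
  "integration_order p tb yH y \<longleftrightarrow>
     (\<exists>c>0. \<exists>r\<in>O[at_right 0](\<lambda>H. H ^ (p + 2)).
        \<forall>\<^sub>F H in at_right 0.
          norm (yH H (tb + H) - y H (tb + H)) \<le> c * H ^ (p + 1) + r H)"

end

theory Submission imports Defs
begin

text \<open>
  Replacing a coupling variable by a waveform with error \<open>O(H^p)\<close> perturbs the right-hand side
  of a subsystem by \<open>O(H^p)\<close>, hence its exact solution over a step of length \<open>H\<close> only by
  \<open>O(H^(p+1))\<close>. No Gronwall argument is needed, since \<open>H\<close> tends to \<open>0\<close>: as soon as
  \<open>L H \<le> 1/2\<close>, the mean value inequality bounds the maximal error by half of itself plus the
  perturbation. The slow error enters the coupling data of the fast subsystem and is one order
  smaller than the interpolation error.
\<close>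

text \<open>For \<open>0 < H < 1\<close> a remainder bounded by \<open>c * H ^ Suc n\<close> is also
  bounded by \<open>c * H ^ n\<close>, so it is absorbed by enlarging \<open>L\<close> to
  \<open>L + c\<close>. This reduces both notions of order to a single constant times a pure power
  of \<open>H\<close>.\<close>

lemma leading_order_bound:
  fixes L :: real and r :: "real \<Rightarrow> real"
  assumes "L \<ge> 0" and r: "r \<in> O[at_right 0](\<lambda>H. H ^ Suc n)"
  obtains C where "C \<ge> 0" "\<forall>\<^sub>F H in at_right 0. L * H ^ n + r H \<le> C * H ^ n"
proof -
  from r obtain c where "c > 0"
    and c: "\<forall>\<^sub>F H in at_right 0. norm (r H) \<le> c * norm (H ^ Suc n)"
    by (rule landau_o.bigE)
  have "\<forall>\<^sub>F H in at_right 0. H \<in> {0<..<1::real}"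
    by (rule eventually_at_right_real) simp
  with c have "\<forall>\<^sub>F H in at_right 0. L * H ^ n + r H \<le> (L + c) * H ^ n"
  proof eventually_elim
    case (elim H)
    have "r H \<le> c * H ^ Suc n"
      using elim by (simp add: abs_mult power_abs)
    also have "\<dots> \<le> c * H ^ n"
      using elim \<open>c > 0\<close> by (intro mult_left_mono power_decreasing) auto
    finally show ?case
      by (simp add: algebra_simps)
  qed
  then show ?thesis
    using that[of "L + c"] \<open>L \<ge> 0\<close> \<open>c > 0\<close> by simp
qed

lemma waveform_order_bound:
  assumes "waveform_order q tb y w"
  obtains C where "C \<ge> 0"
    "\<forall>\<^sub>F H in at_right 0. \<forall>t\<in>{tb..tb + H}. norm (y H t - w H t) \<le> C * H ^ (q + 1)"
proof -
  from assms obtain L r where "L > 0" and r: "r \<in> O[at_right 0](\<lambda>H. H ^ (q + 2))"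
    and *: "\<forall>\<^sub>F H in at_right 0. \<forall>t\<in>{tb..tb + H}.
          norm (y H t - w H t) \<le> L * H ^ (q + 1) + r H"
    unfolding waveform_order_def by blast
  obtain C where "C \<ge> 0"
    and C: "\<forall>\<^sub>F H in at_right 0. L * H ^ (q + 1) + r H \<le> C * H ^ (q + 1)"
    using leading_order_bound[of L r "q + 1"] \<open>L > 0\<close> r by auto
  from * C have "\<forall>\<^sub>F H in at_right 0. \<forall>t\<in>{tb..tb + H}.
      norm (y H t - w H t) \<le> C * H ^ (q + 1)"
    by eventually_elim force
  then show ?thesis
    using that \<open>C \<ge> 0\<close> by blast
qed

lemma integration_order_bound:
  assumes "integration_order p tb yH y"
  obtains C where "C \<ge> 0"
    "\<forall>\<^sub>F H in at_right 0. norm (yH H (tb + H) - y H (tb + H)) \<le> C * H ^ (p + 1)"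
proof -
  from assms obtain L r where "L > 0" and r: "r \<in> O[at_right 0](\<lambda>H. H ^ (p + 2))"
    and *: "\<forall>\<^sub>F H in at_right 0.
          norm (yH H (tb + H) - y H (tb + H)) \<le> L * H ^ (p + 1) + r H"
    unfolding integration_order_def by blast
  obtain C where "C \<ge> 0"
    and C: "\<forall>\<^sub>F H in at_right 0. L * H ^ (p + 1) + r H \<le> C * H ^ (p + 1)"
    using leading_order_bound[of L r "p + 1"] \<open>L > 0\<close> r by auto
  from * C have "\<forall>\<^sub>F H in at_right 0. norm (yH H (tb + H) - y H (tb + H)) \<le> C * H ^ (p + 1)"
    by eventually_elim linarith
  then show ?thesis
    using that \<open>C \<ge> 0\<close> by blast
qed

text \<open>Here \<delta> stands for a uniform bound on the coupling error. The right-hand sides are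
  compared only along the two solutions, so the same estimate serves the slow and the fast
  subsystem.\<close>

lemma ivp_solution_perturbation:
  fixes y z :: "real \<Rightarrow> 'a::euclidean_space"
  assumes y: "ivp_solution f a b y0 y" and z: "ivp_solution g a b y0 z"
    and diff: "\<And>t. t \<in> {a..b} \<Longrightarrow> norm (f t (y t) - g t (z t)) \<le> L * (norm (y t - z t) + \<delta>)"
    and L: "0 \<le> L" "L * (b - a) \<le> 1 / 2" and t: "t \<in> {a..b}"
  shows "norm (y t - z t) \<le> 2 * L * (b - a) * \<delta>"
proof -
  define e where "e = (\<lambda>t. y t - z t)"
  have cont: "continuous_on {a..b} e"
    using y z unfolding ivp_solution_def e_def by (intro continuous_intros) auto
  have e_a: "e a = 0"
    using y z by (simp add: ivp_solution_def e_def)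
  \<comment> \<open>The derivatives in \<open>ivp_solution\<close> are relative to the closed
    interval; at interior points they are two-sided, as the mean value theorem requires.\<close>
  have deriv: "(e has_vector_derivative f t (y t) - g t (z t)) (at t)" if "t \<in> {a<..<b}" for t
  proof -
    have "(e has_vector_derivative f t (y t) - g t (z t)) (at t within {a..b})"
      using y z that unfolding ivp_solution_def e_def
      by (intro has_vector_derivative_diff) auto
    then show ?thesis
      using that by (simp add: at_within_Icc_at)
  qed
  obtain s where s: "s \<in> {a..b}" and max: "\<And>t. t \<in> {a..b} \<Longrightarrow> norm (e t) \<le> norm (e s)"
    using continuous_attains_sup[OF compact_Icc _ continuous_on_norm[OF cont]] t by blast
  have "norm (e s) \<le> 2 * L * (b - a) * \<delta>"
  proof (cases "a = s")
    case True
    \<comment> \<open>Now \<open>e\<close> vanishes at its maximum, and it remains to see that the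
      bound is nonnegative. No sign of \<delta> is assumed; \<open>diff\<close> at \<open>a\<close>,
      where \<open>e\<close> is \<open>0\<close>, yields
      \<open>0 \<le> L * \<delta>\<close>.\<close>
    have "0 \<le> norm (f s (y s) - g s (z s))"
      by simp
    also have "\<dots> \<le> L * (norm (e s) + \<delta>)"
      using diff[OF s] by (simp add: e_def)
    finally have "0 \<le> 2 * (b - a) * (L * \<delta>)"
      using True e_a s by simp
    then show ?thesis
      using True e_a by (simp add: mult_ac)
  next
    case False
    then have "a < s"
      using s by simp
    moreover have "continuous_on {a..s} e"
      using cont s by (auto intro: continuous_on_subset)
    moreover have "(e has_derivative (\<lambda>h. h *\<^sub>R (f x (y x) - g x (z x)))) (at x)"
      if "a < x" "x < s" for x
      using deriv[of x] that s by (simp add: has_vector_derivative_def)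
    ultimately obtain x where x: "x \<in> {a<..<s}"
      and mv: "norm (e s - e a) \<le> norm ((s - a) *\<^sub>R (f x (y x) - g x (z x)))"
      using mvt_general[of a s e "\<lambda>x h. h *\<^sub>R (f x (y x) - g x (z x))"] by auto
    have "x \<in> {a..b}"
      using x s by simp
    have "norm (e s) \<le> (s - a) * norm (f x (y x) - g x (z x))"
      using mv e_a \<open>a < s\<close> by simp
    also have "\<dots> \<le> (b - a) * norm (f x (y x) - g x (z x))"
      using s by (intro mult_right_mono) auto
    also have "\<dots> \<le> (b - a) * (L * (norm (e x) + \<delta>))"
      using diff[OF \<open>x \<in> {a..b}\<close>] s by (intro mult_left_mono) (auto simp: e_def)
    \<comment> \<open>Maximality at \<open>s\<close> replaces the unknown intermediate point
      \<open>x\<close>, so the estimate closes in \<open>norm (e s)\<close> alone.\<close>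
    also have "\<dots> \<le> (b - a) * (L * (norm (e s) + \<delta>))"
      using max[OF \<open>x \<in> {a..b}\<close>] s L by (intro mult_left_mono) auto
    also have "\<dots> = L * (b - a) * norm (e s) + L * (b - a) * \<delta>"
      by (simp add: algebra_simps)
    \<comment> \<open>Half of \<open>norm (e s)\<close> can be moved to the left-hand side; this is
      the origin of the factor 2 in the claim.\<close>
    also have "L * (b - a) * norm (e s) \<le> 1 / 2 * norm (e s)"
      using L by (intro mult_right_mono) auto
    finally show ?thesis
      by (simp add: algebra_simps)
  qed
  then show ?thesis
    using max[OF t] by (simp add: e_def)
qed

text \<open>The projections are bounded linear and hence commute with differentiation. This puts the
  coupled solution into the decoupled form in which it can be compared with the modified
  problems.\<close>

lemma ivp_solution_Pair:
  assumes "ivp_solution (\<lambda>t (u, v). (f t u v, g t u v)) a b (u0, v0) (\<lambda>t. (u t, v t))"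
  shows "ivp_solution (\<lambda>t y. f t y (v t)) a b u0 u" "ivp_solution (\<lambda>t y. g t (u t) y) a b v0 v"
proof -
  have cont: "continuous_on {a..b} (\<lambda>t. (u t, v t))"
    and deriv: "\<And>t. t \<in> {a<..b} \<Longrightarrow> ((\<lambda>t. (u t, v t)) has_vector_derivative
      (f t (u t) (v t), g t (u t) (v t))) (at t within {a..b})"
    using assms by (auto simp: ivp_solution_def)
  show "ivp_solution (\<lambda>t y. f t y (v t)) a b u0 u"
    using assms continuous_on_fst[OF cont]
      bounded_linear.has_vector_derivative[OF bounded_linear_fst deriv]
    by (auto simp: ivp_solution_def)
  show "ivp_solution (\<lambda>t y. g t (u t) y) a b v0 v"
    using assms continuous_on_snd[OF cont]
      bounded_linear.has_vector_derivative[OF bounded_linear_snd deriv]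
    by (auto simp: ivp_solution_def)
qed

text \<open>The norm of a pair is at most the sum of the norms of its components. The sum separates
  the error of the integrated variable from that of the coupling variable.\<close>

lemma lipschitz_on_Pair_norm_le:
  assumes "L-lipschitz_on UNIV (\<lambda>(u, v). f u v)"
  shows "norm (f u v - f u' v') \<le> L * (norm (u - u') + norm (v - v'))"
proof -
  have "norm (f u v - f u' v') \<le> L * norm ((u, v) - (u', v'))"
    using lipschitz_onD[OF assms, of "(u, v)" "(u', v')"] by (simp add: dist_norm)
  also have "\<dots> \<le> L * (norm (u - u') + norm (v - v'))"
    using norm_Pair_le[of "u - u'" "v - v'"] lipschitz_on_nonneg[OF assms]
    by (intro mult_left_mono) simp_all
  finally show ?thesis .
qed

theorem corollary3:
  fixes fS :: "real \<Rightarrow> real ^ 's \<Rightarrow> real ^ 'f \<Rightarrow> real ^ 's"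
    and fF :: "real \<Rightarrow> real ^ 's \<Rightarrow> real ^ 'f \<Rightarrow> real ^ 'f"
    and t0 tend tb H0 LS LF :: real
    and p m :: nat
    and \<Phi>S :: "(real ^ 's) one_step" and \<Phi>F :: "(real ^ 'f) one_step"
    and yS0 :: "real ^ 's" and yF0 :: "real ^ 'f"
    and yS :: "real \<Rightarrow> real ^ 's" and yF :: "real \<Rightarrow> real ^ 'f"
    and yF_ext :: "real \<Rightarrow> real \<Rightarrow> real ^ 'f"
    and nodes :: "real \<Rightarrow> real list"
    and interp :: "real \<Rightarrow> (real \<times> (real ^ 's)) list \<Rightarrow> real \<Rightarrow> real ^ 's"
    and yS_int :: "real \<Rightarrow> real \<Rightarrow> real ^ 's"
    and yS_hat ySH :: "real \<Rightarrow> real \<Rightarrow> real ^ 's"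
    and yF_hat yFH :: "real \<Rightarrow> real \<Rightarrow> real ^ 'f"
  assumes fS_continuous: "continuous_on ({t0..tend} \<times> UNIV) (\<lambda>(t, u, v). fS t u v)"
    and fF_continuous: "continuous_on ({t0..tend} \<times> UNIV) (\<lambda>(t, u, v). fF t u v)"
    and fS_lipschitz: "\<And>t. t \<in> {t0..tend} \<Longrightarrow> LS-lipschitz_on UNIV (\<lambda>(u, v). fS t u v)"
    and fF_lipschitz: "\<And>t. t \<in> {t0..tend} \<Longrightarrow> LF-lipschitz_on UNIV (\<lambda>(u, v). fF t u v)"
    and p: "p \<ge> 1" and m: "m \<ge> 1"
    and t0: "t0 \<le> tb" and H0: "H0 > 0" and tend: "tb + H0 \<le> tend"
    and exact_coupled: "\<And>H. H \<in> {0<..H0} \<Longrightarrow>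
      ivp_solution (\<lambda>t (u, v). (fS t u v, fF t u v)) tb (tb + H) (yS0, yF0) (\<lambda>t. (yS t, yF t))"
    and extrapolation_continuous: "\<And>H. H \<in> {0<..H0} \<Longrightarrow> continuous_on {tb..tb + H} (yF_ext H)"
    and extrapolation_order: "waveform_order (p - 1) tb (\<lambda>H. yF) yF_ext"
    and exact_slow: "\<And>H. H \<in> {0<..H0} \<Longrightarrow>
      ivp_solution (\<lambda>t y. fS t y (yF_ext H t)) tb (tb + H) yS0 (yS_hat H)"
    and slow_start: "\<And>H. H \<in> {0<..H0} \<Longrightarrow> ySH H tb = yS0"
    and slow_step: "\<And>H. H \<in> {0<..H0} \<Longrightarrow>
      ySH H (tb + H) = \<Phi>S (\<lambda>t y. fS t y (yF_ext H t)) tb yS0 H"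
    and slow_scheme_order: "integration_order p tb ySH yS_hat"
    and nodes: "\<And>H. H \<in> {0<..H0} \<Longrightarrow> set (nodes H) \<subseteq> {tb..tb + H}"
    and interpolation: "\<And>H. H \<in> {0<..H0} \<Longrightarrow> yS_int H = interp H (map (\<lambda>t. (t, ySH H t)) (nodes H))"
    and interpolation_continuous: "\<And>H. H \<in> {0<..H0} \<Longrightarrow> continuous_on {tb..tb + H} (yS_int H)"
    and interpolation_order: "waveform_order (p - 1) tb yS_hat yS_int"
    and exact_fast: "\<And>H. H \<in> {0<..H0} \<Longrightarrow>
      ivp_solution (\<lambda>t y. fF t (yS_int H t) y) tb (tb + H) yF0 (yF_hat H)"
    and fast_steps: "\<And>H. H \<in> {0<..H0} \<Longrightarrow>
      yFH H (tb + H) = steps \<Phi>F (\<lambda>t y. fF t (yS_int H t) y) tb yF0 (H / real m) m"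
    and fast_scheme_order: "integration_order p tb yFH yF_hat"
  shows "(\<lambda>H. norm (ySH H (tb + H) - yS (tb + H))) \<in> O[at_right 0](\<lambda>H. H ^ (p + 1)) \<and>
         (\<lambda>H. norm (yFH H (tb + H) - yF (tb + H))) \<in> O[at_right 0](\<lambda>H. H ^ (p + 1))"
proof -
  have L: "0 \<le> LS" "0 \<le> LF"
    using fS_lipschitz[of tb] fF_lipschitz[of tb] t0 H0 tend
    by (auto intro: lipschitz_on_nonneg)
  \<comment> \<open>Subtraction on naturals is truncated, so this needs
    \<open>p \<ge> 1\<close>.\<close>
  have q: "p - 1 + 1 = p"
    using p by simp
  obtain CE where "CE \<ge> 0"
    and CE: "\<forall>\<^sub>F H in at_right 0. \<forall>t\<in>{tb..tb + H}. norm (yF t - yF_ext H t) \<le> CE * H ^ p"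
    using waveform_order_bound[OF extrapolation_order] unfolding q by blast
  obtain CI where "CI \<ge> 0"
    and CI: "\<forall>\<^sub>F H in at_right 0. \<forall>t\<in>{tb..tb + H}. norm (yS_hat H t - yS_int H t) \<le> CI * H ^ p"
    using waveform_order_bound[OF interpolation_order] unfolding q by blast
  obtain CS where
    CS: "\<forall>\<^sub>F H in at_right 0. norm (ySH H (tb + H) - yS_hat H (tb + H)) \<le> CS * H ^ (p + 1)"
    using integration_order_bound[OF slow_scheme_order] by blast
  obtain CF where
    CF: "\<forall>\<^sub>F H in at_right 0. norm (yFH H (tb + H) - yF_hat H (tb + H)) \<le> CF * H ^ (p + 1)"
    using integration_order_bound[OF fast_scheme_order] by blast
  \<comment> \<open>Below \<open>h\<close> both \<open>LS * H\<close> and \<open>LF * H\<close> are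
    at most \<open>1 / 2\<close>, as the perturbation lemma demands; the summand 1 keeps the
    denominator positive when both Lipschitz constants are 0.\<close>
  define h where "h = min H0 (1 / (2 * (LS + LF + 1)))"
  have "h > 0"
    using H0 L by (simp add: h_def)
  then have "\<forall>\<^sub>F H in at_right 0. H \<in> {0<..<h}"
    by (rule eventually_at_right_real)
  then have small: "\<forall>\<^sub>F H in at_right 0. H \<in> {0<..H0} \<and> LS * H \<le> 1 / 2 \<and> LF * H \<le> 1 / 2"
  proof eventually_elim
    case (elim H)
    then have "H * (LS + LF + 1) \<le> 1 / 2"
      using L by (simp add: h_def field_simps)
    moreover have "0 \<le> H * LS" "0 \<le> H * LF"
      using elim L by simp_all
    ultimately show ?case
      using elim by (simp add: h_def algebra_simps)
  qed
  \<comment> \<open>The perturbation is the extrapolation error \<open>CE * H ^ p\<close>; the step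
    length supplies the extra factor \<open>H\<close>. The bound is kept on the whole macro step
    because it enters the fast coupling data.\<close>
  have slow: "\<forall>\<^sub>F H in at_right 0. \<forall>t\<in>{tb..tb + H}.
      norm (yS t - yS_hat H t) \<le> 2 * LS * CE * H ^ (p + 1)"
    using small CE
  proof eventually_elim
    case (elim H)
    show ?case
    proof
      fix t assume t: "t \<in> {tb..tb + H}"
      have "norm (yS t - yS_hat H t) \<le> 2 * LS * (tb + H - tb) * (CE * H ^ p)"
      proof (rule ivp_solution_perturbation[OF ivp_solution_Pair(1)[OF exact_coupled] exact_slow])
        fix s assume s: "s \<in> {tb..tb + H}"
        then have "s \<in> {t0..tend}"
          using elim t0 tend by auto
        then have "norm (fS s (yS s) (yF s) - fS s (yS_hat H s) (yF_ext H s))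
            \<le> LS * (norm (yS s - yS_hat H s) + norm (yF s - yF_ext H s))"
          by (intro lipschitz_on_Pair_norm_le fS_lipschitz)
        also have "\<dots> \<le> LS * (norm (yS s - yS_hat H s) + CE * H ^ p)"
          using elim s L by (intro mult_left_mono add_left_mono) auto
        finally show "norm (fS s (yS s) (yF s) - fS s (yS_hat H s) (yF_ext H s))
            \<le> LS * (norm (yS s - yS_hat H s) + CE * H ^ p)" .
      qed (use elim L t in auto)
      then show "norm (yS t - yS_hat H t) \<le> 2 * LS * CE * H ^ (p + 1)"
        by (simp add: mult_ac)
    qed
  qed
  have coupling: "\<forall>\<^sub>F H in at_right 0. \<forall>t\<in>{tb..tb + H}.
      norm (yS t - yS_int H t) \<le> (CE + CI) * H ^ p"
    using small slow CI
  proof eventually_elim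
    case (elim H)
    show ?case
    proof
      fix t assume t: "t \<in> {tb..tb + H}"
      have "norm (yS t - yS_int H t) \<le> norm (yS t - yS_hat H t) + norm (yS_hat H t - yS_int H t)"
        using norm_triangle_ineq[of "yS t - yS_hat H t" "yS_hat H t - yS_int H t"] by simp
      also have "\<dots> \<le> 2 * LS * CE * H ^ (p + 1) + CI * H ^ p"
        using elim t by (intro add_mono) auto
      \<comment> \<open>The surplus factor \<open>H\<close> is traded against
        \<open>LS * H \<le> 1 / 2\<close>, which leaves exactly \<open>CE * H ^ p\<close>.\<close>
      also have "2 * LS * CE * H ^ (p + 1) = LS * H * (2 * CE * H ^ p)"
        by simp
      also have "\<dots> \<le> 1 / 2 * (2 * CE * H ^ p)"
        using elim \<open>CE \<ge> 0\<close> by (intro mult_right_mono) auto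
      finally show "norm (yS t - yS_int H t) \<le> (CE + CI) * H ^ p"
        by (simp add: algebra_simps)
    qed
  qed
  \<comment> \<open>The roles are exchanged: the coupling error is now that of \<open>yS_int\<close>
    against the exact \<open>yS\<close>. Nothing is coupled to the fast result afterwards, so the
    end point suffices.\<close>
  have fast: "\<forall>\<^sub>F H in at_right 0.
      norm (yF (tb + H) - yF_hat H (tb + H)) \<le> 2 * LF * (CE + CI) * H ^ (p + 1)"
    using small coupling
  proof eventually_elim
    case (elim H)
    have "norm (yF (tb + H) - yF_hat H (tb + H)) \<le> 2 * LF * (tb + H - tb) * ((CE + CI) * H ^ p)"
    proof (rule ivp_solution_perturbation[OF ivp_solution_Pair(2)[OF exact_coupled] exact_fast])
      fix s assume s: "s \<in> {tb..tb + H}"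
      then have "s \<in> {t0..tend}"
        using elim t0 tend by auto
      then have "norm (fF s (yS s) (yF s) - fF s (yS_int H s) (yF_hat H s))
          \<le> LF * (norm (yS s - yS_int H s) + norm (yF s - yF_hat H s))"
        by (intro lipschitz_on_Pair_norm_le fF_lipschitz)
      also have "\<dots> \<le> LF * (norm (yF s - yF_hat H s) + (CE + CI) * H ^ p)"
        using elim s L by (intro mult_left_mono) (auto simp: add.commute)
      finally show "norm (fF s (yS s) (yF s) - fF s (yS_int H s) (yF_hat H s))
          \<le> LF * (norm (yF s - yF_hat H s) + (CE + CI) * H ^ p)" .
    qed (use elim L in auto)
    then show ?case
      by (simp add: algebra_simps)
  qed
  have "(\<lambda>H. norm (ySH H (tb + H) - yS (tb + H))) \<in> O[at_right 0](\<lambda>H. H ^ (p + 1))"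
  proof (rule bigoI)
    show "\<forall>\<^sub>F H in at_right 0. norm (norm (ySH H (tb + H) - yS (tb + H)))
        \<le> (CS + 2 * LS * CE) * norm (H ^ (p + 1))"
      \<comment> \<open>The error splits at \<open>yS_hat\<close> into the local error of the scheme
        and the coupling error; \<open>small\<close> gives \<open>H > 0\<close>, which removes the
        norm around the power.\<close>
      using small slow CS
    proof eventually_elim
      case (elim H)
      have "norm (ySH H (tb + H) - yS (tb + H))
          \<le> norm (ySH H (tb + H) - yS_hat H (tb + H)) + norm (yS (tb + H) - yS_hat H (tb + H))"
        using norm_triangle_ineq4[of "ySH H (tb + H) - yS_hat H (tb + H)"
            "yS (tb + H) - yS_hat H (tb + H)"] by simp
      also have "\<dots> \<le> CS * H ^ (p + 1) + 2 * LS * CE * H ^ (p + 1)"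
        using elim by (intro add_mono) auto
      finally show ?case
        using elim by (simp add: abs_mult power_abs algebra_simps)
    qed
  qed
  moreover have "(\<lambda>H. norm (yFH H (tb + H) - yF (tb + H))) \<in> O[at_right 0](\<lambda>H. H ^ (p + 1))"
  proof (rule bigoI)
    show "\<forall>\<^sub>F H in at_right 0. norm (norm (yFH H (tb + H) - yF (tb + H)))
        \<le> (CF + 2 * LF * (CE + CI)) * norm (H ^ (p + 1))"
      \<comment> \<open>\<open>CF\<close> measures the error at \<open>tb + H\<close>, so it already
        covers all micro steps of the macro step.\<close>
      using small fast CF
    proof eventually_elim
      case (elim H)
      have "norm (yFH H (tb + H) - yF (tb + H))
          \<le> norm (yFH H (tb + H) - yF_hat H (tb + H)) + norm (yF (tb + H) - yF_hat H (tb + H))"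
        using norm_triangle_ineq4[of "yFH H (tb + H) - yF_hat H (tb + H)"
            "yF (tb + H) - yF_hat H (tb + H)"] by simp
      also have "\<dots> \<le> CF * H ^ (p + 1) + 2 * LF * (CE + CI) * H ^ (p + 1)"
        using elim by (intro add_mono) auto
      finally show ?case
        using elim by (simp add: abs_mult power_abs algebra_simps)
    qed
  qed
  ultimately show ?thesis ..
qed

end
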